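(* Let $P$ be a rectangular parallelepiped in $\mathbb R^3$ and let $D\subset\mathbb R^3$ be a bounded domain with $\overline D\cap\overline P=\varnothing$. Then for any $k_0$ the homogeneous integral equation $$\int_P G(x,y)\,J(y)\,dy=0,\qquad x\in D,$$ has non-trivial solutions $J$. Consequently a solution of the integral equation of the first kind $\int_P G(x,y)J(y)\,dy=u_s(x)$, $x\in D$, is in general not unique. The similar result holds in the case of a domain $P$ of arbitrary shape (in place of the parallelepiped).
   Context: $P=\{x\in\mathbb R^3: a_j<x_j<b_j,\ j=1,2,3\}$ in the parallelepiped case; in the case of arbitrary shape $P$ is a bounded domain in $\mathbb R^3$, again with $\overline D\cap\overline P=\varnothing$. The wavenumber is $k_0>0$, and $G(x,y)=\dfrac{e^{ik_0|x-y|}}{4\pi|x-y|}$ is the Green function of the Helmholtz equation. The unknown $J$ is a function on $P$, $u_s$ is a given function on $D$ (the scattered field), and a solution $J$ of the homogeneous equation is non-trivial if it is not the zero function (up to null sets). A domain is a nonempty connected open set. *)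

theory Defs
  imports "HOL-Analysis.Analysis"
begin

definition domain :: "(real^3) set \<Rightarrow> bool" where
  "domain S \<longleftrightarrow> S \<noteq> {} \<and> open S \<and> connected S"

definition helmholtz_green :: "real \<Rightarrow> real^3 \<Rightarrow> real^3 \<Rightarrow> complex" where
  "helmholtz_green k x y =
     exp (\<i> * of_real (k * norm (x - y))) / of_real (4 * pi * norm (x - y))"

text \<open>
  Functions on \<open>P\<close> and on \<open>D\<close> are total functions of which only the values on \<open>P\<close>,
  respectively \<open>D\<close>, matter. No function space is fixed for the unknown \<open>J\<close>, so it is only
  required that the integrals exist as Lebesgue integrals. This is stated explicitly because the
  library's integral of a non-integrable function is 0. For nonempty \<open>D\<close> with closure disjoint
  from that of a bounded \<open>P\<close> it amounts to \<open>J\<close> being Lebesgue integrable on \<open>P\<close>.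
\<close>

definition first_kind_solution ::
  "real \<Rightarrow> (real^3) set \<Rightarrow> (real^3) set \<Rightarrow> (real^3 \<Rightarrow> complex) \<Rightarrow> (real^3 \<Rightarrow> complex) \<Rightarrow> bool" where
  "first_kind_solution k P D u J \<longleftrightarrow>
     (\<forall>x\<in>D. set_integrable lebesgue P (\<lambda>y. helmholtz_green k x y * J y) \<and>
            (LINT y:P|lebesgue. helmholtz_green k x y * J y) = u x)"

definition eq_ae_on :: "(real^3) set \<Rightarrow> (real^3 \<Rightarrow> complex) \<Rightarrow> (real^3 \<Rightarrow> complex) \<Rightarrow> bool" where
  "eq_ae_on P J J' \<longleftrightarrow> (AE y in lebesgue. y \<in> P \<longrightarrow> J y = J' y)"

definition has_nontrivial_homogeneous_solution ::
  "real \<Rightarrow> (real^3) set \<Rightarrow> (real^3) set \<Rightarrow> bool" where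
  "has_nontrivial_homogeneous_solution k P D \<longleftrightarrow>
     (\<exists>J. first_kind_solution k P D (\<lambda>x. 0) J \<and> \<not> eq_ae_on P J (\<lambda>y. 0))"

text \<open>
  Non-uniqueness is meant for every right-hand side \<open>u\<close> for which the equation is solvable at all:
  no solution is ever the only one.
\<close>

definition solutions_never_unique ::
  "real \<Rightarrow> (real^3) set \<Rightarrow> (real^3) set \<Rightarrow> bool" where
  "solutions_never_unique k P D \<longleftrightarrow>
     (\<forall>u J. first_kind_solution k P D u J \<longrightarrow>
        (\<exists>J'. first_kind_solution k P D u J' \<and> \<not> eq_ae_on P J J'))"

end

theory Submission
  imports Defs
begin

text \<open>
  Let \<open>\<phi>\<close> be twice continuously differentiable with compact support in \<open>P\<close> and put
  \<open>J = \<Delta>\<phi> + k\<^sup>2\<phi>\<close>. For \<open>x\<close> outside \<open>P\<close>, Green's second identity moves the Helmholtz operator onto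
  \<open>G(x, \<cdot>)\<close>, which it annihilates, so \<open>\<integral> G(x,y) J(y) dy = 0\<close>. With
  \<open>\<phi>(y) = max(0, r\<^sup>2 - |y - c|\<^sup>2)\<^sup>3\<close> the function \<open>J\<close> is explicit and positive near the boundary of the
  ball. Green's identity reduces to the vanishing of \<open>\<integral> \<partial>\<^sub>i h\<close> for compactly supported \<open>h\<close>, which
  follows from translation invariance of Lebesgue measure and dominated convergence.
\<close>

section \<open>Integrals of directional derivatives\<close>

lemma integral_directional_derivative_eq_0:
  fixes h h' :: "'a::euclidean_space \<Rightarrow> 'b::{banach, second_countable_topology}"
  assumes int: "integrable lborel h"
    and supp: "\<And>y. y \<notin> cball c r \<Longrightarrow> h y = 0"
    and deriv: "\<And>y. ((\<lambda>t. h (y + t *\<^sub>R e)) has_vector_derivative h' y) (at 0)"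
    and bound: "\<And>y. norm (h' y) \<le> C"
  shows "integrable lborel h'" and "integral\<^sup>L lborel h' = 0"
proof -
  define t where "t = (\<lambda>n. inverse (real (Suc n)))"
  \<comment> \<open>Difference quotients along \<open>e\<close>. Since every step \<open>t n\<close>
    is at most 1, they all vanish outside the single ball \<open>cball c R\<close>.\<close>
  define s where "s = (\<lambda>n y. (h (t n *\<^sub>R e + y) - h y) /\<^sub>R t n)"
  define R where "R = r + norm e"
  have t_pos: "t n > 0" and t_le: "t n \<le> 1" for n
    by (auto simp: t_def field_simps)
  have t_lim: "t \<longlonglongrightarrow> 0"
    unfolding t_def by (rule LIMSEQ_inverse_real_of_nat)
  \<comment> \<open>The assumption differentiates only at parameter 0, but at every base point;
    moving the base point gives the derivative along the whole line.\<close>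
  have line: "((\<lambda>u. h (y + u *\<^sub>R e)) has_vector_derivative h' (y + v *\<^sub>R e)) (at v)" for y v
  proof -
    have "((\<lambda>u. h ((y + v *\<^sub>R e) + (u - v) *\<^sub>R e)) has_vector_derivative
        1 *\<^sub>R h' (y + v *\<^sub>R e)) (at v)"
      by (rule vector_diff_chain_at[of "\<lambda>u. u - v" 1 v
            "\<lambda>w. h ((y + v *\<^sub>R e) + w *\<^sub>R e)", unfolded o_def])
        (use deriv[of "y + v *\<^sub>R e"] in \<open>auto intro!: derivative_eq_intros\<close>)
    thus ?thesis by (simp add: algebra_simps)
  qed
  \<comment> \<open>The mean value inequality bounds the quotients by \<open>C\<close> uniformly in
    \<open>n\<close>, which is what domination requires.\<close>
  have lipschitz: "norm (h (y + v *\<^sub>R e) - h y) \<le> C * \<bar>v\<bar>" for y v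
  proof -
    have "norm (h (y + v *\<^sub>R e) - h (y + 0 *\<^sub>R e)) \<le> C * norm (v - 0)"
    proof (rule differentiable_bound[where S = UNIV and f' = "\<lambda>u w. w *\<^sub>R h' (y + u *\<^sub>R e)"])
      show "onorm (\<lambda>w. w *\<^sub>R h' (y + u *\<^sub>R e)) \<le> C" for u :: real
        by (rule onorm_le) (simp add: mult.commute[of C] mult_left_mono bound)
    qed (use line in \<open>auto simp: has_vector_derivative_def\<close>)
    thus ?thesis by simp
  qed
  have h_meas[measurable]: "h \<in> borel_measurable borel"
    using int by simp
  have shift_int: "integrable lborel (\<lambda>y. h (v + y))"
    and shift: "integral\<^sup>L lborel (\<lambda>y. h (v + y)) = integral\<^sup>L lborel h" for v
  proof -
    have "integrable (distr lborel borel ((+) v)) h"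
      using int by (simp add: lborel_distr_plus)
    thus "integrable lborel (\<lambda>y. h (v + y))"
      by (subst (asm) integrable_distr_eq) auto
    have "integral\<^sup>L (distr lborel borel ((+) v)) h = integral\<^sup>L lborel (\<lambda>y. h (v + y))"
      by (rule integral_distr) auto
    thus "integral\<^sup>L lborel (\<lambda>y. h (v + y)) = integral\<^sup>L lborel h"
      by (simp add: lborel_distr_plus)
  qed
  have s_meas: "s n \<in> borel_measurable lborel" for n
    unfolding s_def by measurable
  \<comment> \<open>By translation invariance both terms of the numerator have the same
    integral.\<close>
  have s_integral: "integral\<^sup>L lborel (s n) = 0" for n
    unfolding s_def using int shift_int shift by simp
  have s_lim: "(\<lambda>n. s n y) \<longlonglongrightarrow> h' y" for y
  proof -
    have "((\<lambda>v. norm ((h (y + v *\<^sub>R e) - h y - v *\<^sub>R h' y) /\<^sub>R norm v)) \<longlongrightarrow> 0) (at 0)"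
      using deriv[of y] by (simp add: has_vector_derivative_def has_derivative_at divide_inverse_commute)
    moreover have "\<forall>\<^sub>F v in at 0. norm ((h (y + v *\<^sub>R e) - h y - v *\<^sub>R h' y) /\<^sub>R norm v) =
        norm ((h (y + v *\<^sub>R e) - h y) /\<^sub>R v - h' y)"
      unfolding eventually_at_filter
    proof (intro always_eventually allI impI)
      fix v :: real assume "v \<noteq> 0"
      hence "(h (y + v *\<^sub>R e) - h y) /\<^sub>R v - h' y = (h (y + v *\<^sub>R e) - h y - v *\<^sub>R h' y) /\<^sub>R v"
        by (simp add: scaleR_diff_right)
      thus "norm ((h (y + v *\<^sub>R e) - h y - v *\<^sub>R h' y) /\<^sub>R norm v) =
          norm ((h (y + v *\<^sub>R e) - h y) /\<^sub>R v - h' y)"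
        by simp
    qed
    ultimately have "((\<lambda>v. norm ((h (y + v *\<^sub>R e) - h y) /\<^sub>R v - h' y)) \<longlongrightarrow> 0) (at 0)"
      by (rule Lim_transform_eventually)
    hence "((\<lambda>v. (h (y + v *\<^sub>R e) - h y) /\<^sub>R v) \<longlongrightarrow> h' y) (at 0)"
      by (simp only: tendsto_norm_zero_iff Lim_null[symmetric])
    moreover have "filterlim t (at 0) sequentially"
      using t_lim t_pos by (simp add: filterlim_at less_imp_neq[symmetric])
    ultimately have "(\<lambda>n. (h (y + t n *\<^sub>R e) - h y) /\<^sub>R t n) \<longlonglongrightarrow> h' y"
      by (rule filterlim_compose)
    thus ?thesis
      by (simp add: s_def add.commute)
  qed
  \<comment> \<open>Inside the larger ball the Lipschitz bound applies. Outside it, both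
    \<open>y\<close> and the shifted point miss \<open>cball c r\<close>, so the quotient is
    0.\<close>
  have s_bound: "norm (s n y) \<le> indicator (cball c R) y *\<^sub>R C" for n y
  proof (cases "y \<in> cball c R")
    case True
    have "norm (h (t n *\<^sub>R e + y) - h y) \<le> C * t n"
      using lipschitz[of y "t n"] t_pos[of n] by (simp add: add.commute)
    thus ?thesis
      using True t_pos[of n] by (simp add: s_def pos_divide_le_eq divide_inverse_commute[symmetric])
  next
    case False
    have "norm (t n *\<^sub>R e) \<le> norm e"
      using t_pos[of n] t_le[of n] by (simp add: mult_left_le_one_le)
    moreover have "dist c y \<le> dist c (t n *\<^sub>R e + y) + norm (t n *\<^sub>R e)"
      by (metis add_diff_cancel_right' dist_commute dist_norm dist_triangle)
    ultimately have "t n *\<^sub>R e + y \<notin> cball c r"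
      using False by (auto simp: R_def)
    moreover have "y \<notin> cball c r"
      using False norm_ge_zero[of e] unfolding R_def mem_cball by linarith
    ultimately show ?thesis
      using False supp by (simp add: s_def)
  qed
  \<comment> \<open>Measurability of \<open>h'\<close> is inherited from the quotients through the
    pointwise limit.\<close>
  have h'_meas: "h' \<in> borel_measurable lborel"
    by (rule borel_measurable_LIMSEQ_metric[OF s_meas s_lim])
  have dom: "integrable lborel (\<lambda>y. indicator (cball c R) y *\<^sub>R C)"
    by (rule borel_integrable_compact) auto
  show "integrable lborel h'"
    by (rule integrable_dominated_convergence[where s = s, OF h'_meas s_meas dom])
      (use s_lim s_bound in auto)
  have "(\<lambda>n. integral\<^sup>L lborel (s n)) \<longlonglongrightarrow> integral\<^sup>L lborel h'"
    by (rule integral_dominated_convergence[where s = s, OF h'_meas s_meas dom])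
      (use s_lim s_bound in auto)
  thus "integral\<^sup>L lborel h' = 0"
    using s_integral by (simp add: LIMSEQ_const_iff)
qed

section \<open>Differentiability of truncated powers\<close>

text \<open>Only the kink at 0 is delicate: there the difference quotient is
  \<open>max 0 h ^ n\<close>, which tends to 0 because \<open>n > 0\<close>. For
  \<open>n = 0\<close> the function has a corner.\<close>

lemma has_real_derivative_max_0_power:
  fixes x :: real
  assumes "n > 0"
  shows "((\<lambda>x. max 0 x ^ Suc n) has_real_derivative real (Suc n) * max 0 x ^ n) (at x)"
proof (cases x "0::real" rule: linorder_cases)
  case less
  show ?thesis
    by (rule has_field_derivative_transform_within_open[where f = "\<lambda>_. 0" and S = "{..<0}"])
      (use less assms in \<open>auto simp: max_def zero_power\<close>)
next
  case equal
  have "((\<lambda>h. max 0 h ^ Suc n / h) \<longlongrightarrow> 0) (at (0::real))"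
  proof (rule Lim_transform_eventually)
    have "((\<lambda>h::real. max 0 h ^ n) \<longlongrightarrow> max 0 0 ^ n) (at 0)"
      by (intro tendsto_intros)
    thus "((\<lambda>h::real. max 0 h ^ n) \<longlongrightarrow> 0) (at 0)"
      by (simp only: max.idem zero_power[OF assms])
    show "\<forall>\<^sub>F h in at (0::real). max 0 h ^ n = max 0 h ^ Suc n / h"
      unfolding eventually_at_filter using assms by (auto intro!: always_eventually simp: max_def)
  qed
  thus ?thesis
    using equal assms by (simp add: has_field_derivative_iff zero_power)
next
  case greater
  show ?thesis
    by (rule has_field_derivative_transform_within_open[where f = "\<lambda>x. x ^ Suc n" and S = "{0<..}"])
      (use greater in \<open>auto intro!: derivative_eq_intros simp del: power_Suc\<close>)
qed

section \<open>The Green function in terms of the squared distance\<close>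

text \<open>
  A radial function is written as a function of the squared distance \<open>\<sigma>\<close>: if \<open>u(y) = F(|y - c|\<^sup>2)\<close> on
  three-dimensional space, then \<open>\<partial>\<^sub>i u = 2 (y\<^sub>i - c\<^sub>i) F'\<close> and \<open>\<Delta>u = 4 \<sigma> F'' + 6 F'\<close>.
\<close>

definition green_radial :: "real \<Rightarrow> real \<Rightarrow> complex" where
  "green_radial k \<sigma> = exp (\<i> * of_real (k * sqrt \<sigma>)) / of_real (4 * pi * sqrt \<sigma>)"

text \<open>With \<rho> = sqrt \<sigma>, differentiation in \<rho> gives the factor (i k \<rho> - 1)
  / \<rho>, and the chain rule adds 1 / (2 \<rho>). Keeping \<open>green_radial\<close> as a factor,
  here and in the second derivative, turns the Helmholtz equation into algebra.\<close>

definition green_radial' :: "real \<Rightarrow> real \<Rightarrow> complex" where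
  "green_radial' k \<sigma> = green_radial k \<sigma> * (\<i> * of_real (k * sqrt \<sigma>) - 1) / of_real (2 * \<sigma>)"

definition green_radial'' :: "real \<Rightarrow> real \<Rightarrow> complex" where
  "green_radial'' k \<sigma> =
     green_radial k \<sigma> * (3 - 3 * \<i> * of_real (k * sqrt \<sigma>) - of_real (k\<^sup>2 * \<sigma>)) / of_real (4 * \<sigma>\<^sup>2)"

lemma helmholtz_green_eq_green_radial:
  "helmholtz_green k x y = green_radial k ((norm (y - x))\<^sup>2)"
  by (simp add: helmholtz_green_def green_radial_def norm_minus_commute)

text \<open>The kernel is differentiated as a holomorphic function of a complex variable and then
  composed with the real curve sending \<open>u\<close> to \<open>sqrt u\<close>.\<close>

lemma has_vector_derivative_green_radial:
  assumes "\<sigma> > 0"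
  shows "(green_radial k has_vector_derivative green_radial' k \<sigma>) (at \<sigma>)"
proof -
  define q where "q = complex_of_real (sqrt \<sigma>)"
  have q: "q \<noteq> 0" "q * q = of_real \<sigma>"
    using assms by (auto simp: q_def simp flip: of_real_mult)
  have "((\<lambda>z. exp (\<i> * of_real k * z) / (4 * of_real pi * z)) has_field_derivative
      exp (\<i> * of_real k * q) * (\<i> * of_real k * q - 1) / (4 * of_real pi * (q * q))) (at q)"
    using q(1) by (auto intro!: derivative_eq_intros simp: field_simps)
  moreover have "((\<lambda>u. complex_of_real (sqrt u)) has_vector_derivative of_real (inverse (sqrt \<sigma>) / 2)) (at \<sigma>)"
    using assms by (auto intro!: derivative_eq_intros)
  ultimately have "((\<lambda>u. exp (\<i> * of_real k * of_real (sqrt u)) / (4 * of_real pi * of_real (sqrt u)))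
      has_vector_derivative of_real (inverse (sqrt \<sigma>) / 2) *
        (exp (\<i> * of_real k * q) * (\<i> * of_real k * q - 1) / (4 * of_real pi * (q * q)))) (at \<sigma>)"
    unfolding q_def by (rule field_vector_diff_chain_at[unfolded o_def, rotated])
  moreover have "of_real (inverse (sqrt \<sigma>) / 2) *
        (exp (\<i> * of_real k * q) * (\<i> * of_real k * q - 1) / (4 * of_real pi * (q * q))) = green_radial' k \<sigma>"
    using q by (simp add: green_radial'_def green_radial_def field_simps flip: q_def)
  ultimately show ?thesis
    by (simp add: green_radial_def[abs_def] mult.assoc)
qed

text \<open>Product rule for \<open>green_radial\<close> and a factor that is rational in
  \<open>sqrt u\<close>; that factor is again differentiated over the complex numbers first.\<close>

lemma has_vector_derivative_green_radial':
  assumes "\<sigma> > 0"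
  shows "(green_radial' k has_vector_derivative green_radial'' k \<sigma>) (at \<sigma>)"
proof -
  define q where "q = complex_of_real (sqrt \<sigma>)"
  have q: "q \<noteq> 0" "of_real \<sigma> = q * q"
    using assms by (auto simp: q_def simp flip: of_real_mult)
  have *: "((\<lambda>z. (\<i> * of_real k * z - 1) / (2 * z\<^sup>2)) has_field_derivative
      (2 - \<i> * of_real k * q) / (2 * q ^ 3)) (at q)"
    using q(1) by (auto intro!: derivative_eq_intros simp: field_simps power2_eq_square power3_eq_cube)
  have "((\<lambda>u. complex_of_real (sqrt u)) has_vector_derivative of_real (inverse (sqrt \<sigma>) / 2)) (at \<sigma>)"
    using assms by (auto intro!: derivative_eq_intros)
  from field_vector_diff_chain_at[OF this *[unfolded q_def], unfolded o_def]
  have "((\<lambda>u. (\<i> * of_real k * of_real (sqrt u) - 1) / (2 * (of_real (sqrt u))\<^sup>2))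
      has_vector_derivative of_real (inverse (sqrt \<sigma>) / 2) *
        ((2 - \<i> * of_real k * q) / (2 * q ^ 3))) (at \<sigma>)"
    by (simp add: q_def)
  note has_vector_derivative_mult[OF has_vector_derivative_green_radial[OF assms, of k] this]
  moreover have "green_radial k \<sigma> * (of_real (inverse (sqrt \<sigma>) / 2) * ((2 - \<i> * of_real k * q) / (2 * q ^ 3))) +
      green_radial' k \<sigma> * ((\<i> * of_real k * of_real (sqrt \<sigma>) - 1) / (2 * (of_real (sqrt \<sigma>))\<^sup>2)) =
      green_radial'' k \<sigma>"
    using q by (simp add: green_radial''_def green_radial'_def field_simps power2_eq_square
        power3_eq_cube flip: q_def)
  ultimately have "((\<lambda>u. green_radial k u * ((\<i> * of_real k * of_real (sqrt u) - 1) / (2 * (of_real (sqrt u))\<^sup>2)))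
      has_vector_derivative green_radial'' k \<sigma>) (at \<sigma>)"
    by (simp only:)
  \<comment> \<open>The definition divides by \<open>2 * u\<close> rather than by twice the square
    of \<open>sqrt u\<close>; the two agree for positive \<open>u\<close>, hence near
    \<sigma>.\<close>
  thus ?thesis
    by (rule has_vector_derivative_transform_within_open[where S = "{0<..}"])
      (use assms in \<open>auto simp: green_radial'_def simp flip: of_real_power\<close>)
qed

text \<open>By the radial form of the Laplacian this is \<Delta>G + k^2 G = 0 away from the
  singularity. After division by G it reads (3 - 3 i k \<rho> - k^2 \<sigma>) / \<sigma> + 3 (i k
  \<rho> - 1) / \<sigma> = - k^2.\<close>

lemma green_radial_helmholtz:
  assumes "\<sigma> > 0"
  shows "4 * of_real \<sigma> * green_radial'' k \<sigma> + 6 * green_radial' k \<sigma> =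
    - of_real (k\<^sup>2) * green_radial k \<sigma>"
  using assms
  by (simp add: green_radial''_def green_radial'_def field_simps power2_eq_square)

lemma continuous_on_green_radial:
  assumes "\<And>y. y \<in> S \<Longrightarrow> f y > 0" "continuous_on S f"
  shows "continuous_on S (\<lambda>y. green_radial k (f y))"
    and "continuous_on S (\<lambda>y. green_radial' k (f y))"
    and "continuous_on S (\<lambda>y. green_radial'' k (f y))"
  using assms unfolding green_radial''_def green_radial'_def green_radial_def
  by (force intro!: continuous_intros)+

section \<open>The bump function and its derivatives\<close>

text \<open>The profile of \<phi> in the squared distance. The exponent 3 is the least natural one
  that leaves the second derivative continuous across the sphere.\<close>

definition bump :: "real \<Rightarrow> real \<Rightarrow> real" where
  "bump r s = max 0 (r\<^sup>2 - s) ^ 3"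

definition bump' :: "real \<Rightarrow> real \<Rightarrow> real" where
  "bump' r s = - 3 * max 0 (r\<^sup>2 - s) ^ 2"

definition bump'' :: "real \<Rightarrow> real \<Rightarrow> real" where
  "bump'' r s = 6 * max 0 (r\<^sup>2 - s)"

lemma has_real_derivative_bump:
  "(bump r has_real_derivative bump' r s) (at s)"
  "(bump' r has_real_derivative bump'' r s) (at s)"
proof -
  have d: "((\<lambda>s. max 0 (r\<^sup>2 - s) ^ Suc n) has_real_derivative
      real (Suc n) * max 0 (r\<^sup>2 - s) ^ n * (- 1)) (at s)" if "n > 0" for n
    by (rule DERIV_chain'[where f = "\<lambda>s. r\<^sup>2 - s", OF _ has_real_derivative_max_0_power[OF that]])
      (auto intro!: derivative_eq_intros)
  show "(bump r has_real_derivative bump' r s) (at s)"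
    using d[of 2] by (simp add: bump_def[abs_def] bump'_def)
  show "(bump' r has_real_derivative bump'' r s) (at s)"
    using DERIV_cmult[OF d[of 1], of "- 3"] by (simp add: bump'_def[abs_def] bump''_def numeral_2_eq_2)
qed

lemma bump_eq_0:
  fixes c y :: "'a::euclidean_space"
  assumes "r > 0" "y \<notin> ball c r"
  shows "bump r ((norm (y - c))\<^sup>2) = 0" "bump' r ((norm (y - c))\<^sup>2) = 0"
    "bump'' r ((norm (y - c))\<^sup>2) = 0"
proof -
  have "r\<^sup>2 \<le> (norm (y - c))\<^sup>2"
    using assms by (intro power_mono) (auto simp: dist_norm norm_minus_commute)
  thus "bump r ((norm (y - c))\<^sup>2) = 0" "bump' r ((norm (y - c))\<^sup>2) = 0"
    "bump'' r ((norm (y - c))\<^sup>2) = 0"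
    by (auto simp: bump_def bump'_def bump''_def)
qed

lemma continuous_on_bump:
  assumes "continuous_on S f"
  shows "continuous_on S (\<lambda>y. bump r (f y))"
    and "continuous_on S (\<lambda>y. bump' r (f y))"
    and "continuous_on S (\<lambda>y. bump'' r (f y))"
  using assms unfolding bump_def bump'_def bump''_def by (auto intro!: continuous_intros)

section \<open>Green's second identity in one direction\<close>

lemma has_real_derivative_norm_power2_line:
  fixes c e y :: "'a::euclidean_space"
  shows "((\<lambda>t. (norm (y + t *\<^sub>R e - c))\<^sup>2) has_real_derivative 2 * ((y - c) \<bullet> e)) (at 0)"
  unfolding power2_norm_eq_inner
  by (auto intro!: derivative_eq_intros simp: has_field_derivative_def algebra_simps
      inner_commute)

text \<open>
  The integrand is the divergence, taken one coordinate at a time, of the field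
  \<open>G \<nabla>\<phi> - \<phi> \<nabla>G\<close> in Green's second identity.
\<close>

lemma integral_green_identity_component:
  fixes c x e :: "'a::euclidean_space" and k r :: real
  assumes r: "r > 0" and x: "x \<notin> cball c r" and e: "e \<bullet> e = 1"
  defines "f \<equiv> \<lambda>y.
      green_radial k ((norm (y - x))\<^sup>2) *
        of_real (4 * ((y - c) \<bullet> e)\<^sup>2 * bump'' r ((norm (y - c))\<^sup>2) + 2 * bump' r ((norm (y - c))\<^sup>2)) -
      of_real (bump r ((norm (y - c))\<^sup>2)) *
        (of_real (4 * ((y - x) \<bullet> e)\<^sup>2) * green_radial'' k ((norm (y - x))\<^sup>2) +
         2 * green_radial' k ((norm (y - x))\<^sup>2))"
  shows "integrable lborel f" and "integral\<^sup>L lborel f = 0"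
proof -
  \<comment> \<open>The component along \<open>e\<close> of the field. In its derivative along
    \<open>e\<close> the products of first derivatives of G and \<phi> cancel, which leaves
    \<open>f\<close>.\<close>
  define h where "h = (\<lambda>y.
      green_radial k ((norm (y - x))\<^sup>2) * of_real (2 * ((y - c) \<bullet> e) * bump' r ((norm (y - c))\<^sup>2)) -
      of_real (bump r ((norm (y - c))\<^sup>2)) *
        (of_real (2 * ((y - x) \<bullet> e)) * green_radial' k ((norm (y - x))\<^sup>2)))"
  have pos: "0 < (norm (y - x))\<^sup>2" if "y \<in> cball c r" for y
    using that x by auto
  have cont: "continuous_on (cball c r) (\<lambda>y. (norm (y - z))\<^sup>2)" for z
    by (intro continuous_intros)
  note cont_intros = continuous_intros continuous_on_green_radial[OF pos cont]
    continuous_on_bump[OF cont]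
  have h_cont: "continuous_on (cball c r) h"
    unfolding h_def by (intro cont_intros)
  have f_cont: "continuous_on (cball c r) f"
    unfolding f_def by (intro cont_intros)
  have out: "h y = 0" "f y = 0" if "y \<notin> cball c r" for y
    using bump_eq_0[OF r, of y c] that by (auto simp: h_def f_def)
  have "integrable lborel (\<lambda>y. indicator (cball c r) y *\<^sub>R h y)"
    by (rule borel_integrable_compact[OF compact_cball h_cont])
  also have "(\<lambda>y. indicator (cball c r) y *\<^sub>R h y) = h"
    using out by (auto simp: indicator_def fun_eq_iff)
  finally have h_int: "integrable lborel h" .
  have "bounded (f ` cball c r)"
    using f_cont compact_cball compact_continuous_image compact_imp_bounded by blast
  then obtain C where C: "C > 0" "\<And>y. y \<in> cball c r \<Longrightarrow> norm (f y) \<le> C"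
    by (auto simp: bounded_pos)
  have f_bound: "norm (f y) \<le> C" for y
    using C out by (cases "y \<in> cball c r") auto
  have deriv: "((\<lambda>t. h (y + t *\<^sub>R e)) has_vector_derivative f y) (at 0)" for y
  \<comment> \<open>On the closed ball G is smooth, so the product rule applies, even on the sphere.
    Off it \<open>h\<close> vanishes in a neighbourhood, which also covers the singular point
    \<open>y = x\<close>.\<close>
  proof (cases "y \<in> cball c r")
    case False
    have "open ((\<lambda>t::real. y + t *\<^sub>R e) -` (- cball c r))"
      by (intro open_vimage continuous_intros) (auto simp: open_Compl)
    hence "((\<lambda>t. h (y + t *\<^sub>R e)) has_vector_derivative 0) (at 0)"
      by (rule has_vector_derivative_transform_within_open[rotated, where f = "\<lambda>_. 0"])
        (use False out in auto)
    thus ?thesis using out(2)[OF False] by simp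
  next
    case True
    note p = pos[OF True]
    have nx: "((\<lambda>t. (norm (y + t *\<^sub>R e - x))\<^sup>2) has_vector_derivative 2 * ((y - x) \<bullet> e)) (at 0)"
      using has_real_derivative_norm_power2_line[of y e x]
      by (simp add: has_real_derivative_iff_has_vector_derivative)
    have lin: "((\<lambda>t. of_real (2 * ((y + t *\<^sub>R e - z) \<bullet> e))) has_vector_derivative complex_of_real 2) (at 0)" for z
      by (rule has_vector_derivative_of_real)
        (auto intro!: derivative_eq_intros simp: inner_add_left inner_diff_left e)
    have g: "((\<lambda>t. green_radial k ((norm (y + t *\<^sub>R e - x))\<^sup>2)) has_vector_derivative
        (2 * ((y - x) \<bullet> e)) *\<^sub>R green_radial' k ((norm (y - x))\<^sup>2)) (at 0)"
      using vector_diff_chain_at[OF nx, of "green_radial k"] has_vector_derivative_green_radial[OF p]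
      by (simp add: o_def)
    have g': "((\<lambda>t. green_radial' k ((norm (y + t *\<^sub>R e - x))\<^sup>2)) has_vector_derivative
        (2 * ((y - x) \<bullet> e)) *\<^sub>R green_radial'' k ((norm (y - x))\<^sup>2)) (at 0)"
      using vector_diff_chain_at[OF nx, of "green_radial' k"] has_vector_derivative_green_radial'[OF p]
      by (simp add: o_def)
    have b: "((\<lambda>t. of_real (bump r ((norm (y + t *\<^sub>R e - c))\<^sup>2))) has_vector_derivative
        complex_of_real (2 * ((y - c) \<bullet> e) * bump' r ((norm (y - c))\<^sup>2))) (at 0)"
      using DERIV_chain'[OF has_real_derivative_norm_power2_line[of y e c] has_real_derivative_bump(1)[of r]]
      by (intro has_vector_derivative_of_real) (simp add: mult.commute)
    have b': "((\<lambda>t. of_real (bump' r ((norm (y + t *\<^sub>R e - c))\<^sup>2))) has_vector_derivative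
        complex_of_real (2 * ((y - c) \<bullet> e) * bump'' r ((norm (y - c))\<^sup>2))) (at 0)"
      using DERIV_chain'[OF has_real_derivative_norm_power2_line[of y e c] has_real_derivative_bump(2)[of r]]
      by (intro has_vector_derivative_of_real) (simp add: mult.commute)
    have "((\<lambda>t. green_radial k ((norm (y + t *\<^sub>R e - x))\<^sup>2) *
          (of_real (2 * ((y + t *\<^sub>R e - c) \<bullet> e)) * of_real (bump' r ((norm (y + t *\<^sub>R e - c))\<^sup>2))) -
        of_real (bump r ((norm (y + t *\<^sub>R e - c))\<^sup>2)) *
          (of_real (2 * ((y + t *\<^sub>R e - x) \<bullet> e)) * green_radial' k ((norm (y + t *\<^sub>R e - x))\<^sup>2)))
      has_vector_derivative f y) (at 0)"
      by (rule back_subst[where P = "\<lambda>d. (_ has_vector_derivative d) (at 0)"],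
          rule has_vector_derivative_diff[OF
            has_vector_derivative_mult[OF g has_vector_derivative_mult[OF lin b']]
            has_vector_derivative_mult[OF b has_vector_derivative_mult[OF lin g']]])
        (simp add: f_def scaleR_conv_of_real algebra_simps power2_eq_square)
    thus ?thesis by (simp add: h_def)
  qed
  show "integrable lborel f" "integral\<^sup>L lborel f = 0"
    by (rule integral_directional_derivative_eq_0[OF h_int out(1) deriv f_bound], assumption)+
qed

section \<open>The explicit source and its potential\<close>

text \<open>This is \<Delta>\<phi> + k^2 \<phi> with the Laplacian in radial form; the coefficient 6
  is twice the dimension.\<close>

definition bump_source :: "real \<Rightarrow> real^3 \<Rightarrow> real \<Rightarrow> real^3 \<Rightarrow> real" where
  "bump_source k c r y =
     4 * (norm (y - c))\<^sup>2 * bump'' r ((norm (y - c))\<^sup>2) + 6 * bump' r ((norm (y - c))\<^sup>2) +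
     k\<^sup>2 * bump r ((norm (y - c))\<^sup>2)"

lemma bump_source_eq_0:
  assumes "r > 0" "y \<notin> ball c r"
  shows "bump_source k c r y = 0"
  using bump_eq_0[OF assms] by (simp add: bump_source_def)

text \<open>Summing the one-directional identities over the basis gives the integrand G
  \<Delta>\<phi> - \<phi> \<Delta>G, and \<Delta>G = - k^2 G turns it into G (\<Delta>\<phi> + k^2
  \<phi>).\<close>

lemma integral_green_bump_source:
  assumes r: "r > 0" and x: "x \<notin> cball c r"
  shows "integrable lborel (\<lambda>y. helmholtz_green k x y * of_real (bump_source k c r y))"
    and "integral\<^sup>L lborel (\<lambda>y. helmholtz_green k x y * of_real (bump_source k c r y)) = 0"
proof -
  define f where "f = (\<lambda>e y.
      green_radial k ((norm (y - x))\<^sup>2) *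
        of_real (4 * ((y - c) \<bullet> e)\<^sup>2 * bump'' r ((norm (y - c))\<^sup>2) + 2 * bump' r ((norm (y - c))\<^sup>2)) -
      of_real (bump r ((norm (y - c))\<^sup>2)) *
        (of_real (4 * ((y - x) \<bullet> e)\<^sup>2) * green_radial'' k ((norm (y - x))\<^sup>2) +
         2 * green_radial' k ((norm (y - x))\<^sup>2)))"
  have f: "integrable lborel (f e)" "integral\<^sup>L lborel (f e) = 0" if "e \<in> Basis" for e
    using integral_green_identity_component[OF r x, of e k] that by (auto simp: f_def)
  have sq: "(\<Sum>e\<in>Basis. complex_of_real ((v \<bullet> e)\<^sup>2)) = of_real ((norm v)\<^sup>2)" for v :: "real^3"
    unfolding of_real_sum[symmetric] power2_norm_eq_inner
    by (subst euclidean_inner) (simp only: power2_eq_square)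
  have "(\<Sum>e\<in>Basis. f e y) = helmholtz_green k x y * of_real (bump_source k c r y)" for y
  proof -
    define G where "G = green_radial k ((norm (y - x))\<^sup>2)"
    define G' where "G' = green_radial' k ((norm (y - x))\<^sup>2)"
    define G'' where "G'' = green_radial'' k ((norm (y - x))\<^sup>2)"
    define w where "w = bump r ((norm (y - c))\<^sup>2)"
    define w' where "w' = bump' r ((norm (y - c))\<^sup>2)"
    define w'' where "w'' = bump'' r ((norm (y - c))\<^sup>2)"
    have "(\<Sum>e\<in>Basis. f e y) = (\<Sum>e\<in>Basis.
        4 * G * of_real w'' * of_real (((y - c) \<bullet> e)\<^sup>2) + 2 * G * of_real w' -
        4 * of_real w * G'' * of_real (((y - x) \<bullet> e)\<^sup>2) - 2 * of_real w * G')"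
      by (intro sum.cong) (simp_all add: f_def G_def G'_def G''_def w_def w'_def w''_def algebra_simps)
    also have "\<dots> = 4 * G * of_real w'' * of_real ((norm (y - c))\<^sup>2) + 6 * G * of_real w' -
        of_real w * (4 * of_real ((norm (y - x))\<^sup>2) * G'' + 6 * G')"
      by (simp only: sum.distrib sum_subtractf sum_distrib_left[symmetric] sq)
        (simp add: algebra_simps)
    also have "\<dots> = G * of_real (4 * (norm (y - c))\<^sup>2 * w'' + 6 * w' + k\<^sup>2 * w)"
    proof (cases "y = x")
      case True
      hence "w = 0"
        using bump_eq_0(1)[OF r, of y c] x by (auto simp: w_def)
      thus ?thesis by (simp add: algebra_simps)
    next
      case False
      hence "4 * of_real ((norm (y - x))\<^sup>2) * G'' + 6 * G' = - of_real (k\<^sup>2) * G"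
        unfolding G_def G'_def G''_def by (intro green_radial_helmholtz) simp
      thus ?thesis by (simp only:) (simp add: algebra_simps)
    qed
    finally show ?thesis
      by (simp add: helmholtz_green_eq_green_radial bump_source_def G_def w_def w'_def w''_def)
  qed
  hence eq: "(\<lambda>y. helmholtz_green k x y * of_real (bump_source k c r y)) = (\<lambda>y. \<Sum>e\<in>Basis. f e y)"
    by simp
  show "integrable lborel (\<lambda>y. helmholtz_green k x y * of_real (bump_source k c r y))"
    unfolding eq using f by (intro Bochner_Integration.integrable_sum) auto
  show "integral\<^sup>L lborel (\<lambda>y. helmholtz_green k x y * of_real (bump_source k c r y)) = 0"
    unfolding eq using f by (subst Bochner_Integration.integral_sum) auto
qed

text \<open>With s the squared distance and q = r^2 - s, the source factors as q (24 s - 18 q + k^2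
  q^2). The bound s > r^2 / 2 says q < s, so 24 s outweighs 18 q.\<close>

lemma bump_source_pos:
  assumes r: "r > 0" and y: "r\<^sup>2 / 2 < (norm (y - c))\<^sup>2" "(norm (y - c))\<^sup>2 < r\<^sup>2"
  shows "bump_source k c r y > 0"
proof -
  define s where "s = (norm (y - c))\<^sup>2"
  define q where "q = r\<^sup>2 - s"
  have q: "q > 0" "q < s"
    using y by (auto simp: q_def s_def)
  have "bump_source k c r y = q * (24 * s - 18 * q + k\<^sup>2 * q\<^sup>2)"
    unfolding bump_source_def bump_def bump'_def bump''_def s_def[symmetric] q_def[symmetric]
    using q by (simp add: algebra_simps power2_eq_square power3_eq_cube)
  also have "\<dots> > 0"
    using q by (intro mult_pos_pos add_pos_nonneg) auto
  finally show ?thesis .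
qed

text \<open>The source is positive on an open shell inside the ball, and a nonempty open set is not
  a null set.\<close>

lemma not_eq_ae_on_bump_source:
  assumes r: "r > 0" and P: "ball c r \<subseteq> P"
  shows "\<not> eq_ae_on P (\<lambda>y. of_real (bump_source k c r y)) (\<lambda>y. 0)"
proof
  define A where "A = {y. r\<^sup>2 / 2 < (norm (y - c))\<^sup>2} \<inter> {y. (norm (y - c))\<^sup>2 < r\<^sup>2}"
  have "open A"
    unfolding A_def by (intro open_Int open_Collect_less continuous_intros)
  \<comment> \<open>A point of the shell: the square of 3/4 is 9/16, strictly between 1/2 and
    1.\<close>
  obtain u :: "real^3" where u: "norm u = 3 / 4 * r"
    using vector_choose_size[of "3 / 4 * r"] r by auto
  have "c + u \<in> A"
    using r by (simp add: A_def u power2_eq_square)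
  assume "eq_ae_on P (\<lambda>y. of_real (bump_source k c r y)) (\<lambda>y. 0)"
  hence "AE y in lebesgue. y \<in> P \<longrightarrow> bump_source k c r y = 0"
    by (simp add: eq_ae_on_def)
  hence "AE y in lebesgue. y \<notin> A"
  proof eventually_elim
    case (elim y)
    show ?case
    proof
      assume y: "y \<in> A"
      hence "norm (y - c) < r"
        using r by (auto simp: A_def intro: power_less_imp_less_base)
      hence "y \<in> P"
        using P by (auto simp: dist_norm norm_minus_commute)
      thus False
        using elim bump_source_pos[OF r, of y c k] y by (auto simp: A_def)
    qed
  qed
  hence "negligible A"
    using \<open>open A\<close> by (simp add: negligible_iff_null_sets AE_iff_null_sets)
  thus False
    using open_not_negligible[OF \<open>open A\<close>] \<open>c + u \<in> A\<close> by auto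
qed

section \<open>Homogeneous solutions and non-uniqueness\<close>

lemma first_kind_solution_bump_source:
  assumes r: "r > 0" and P: "cball c r \<subseteq> P" and D: "D \<inter> P = {}"
  shows "first_kind_solution k P D (\<lambda>x. 0) (\<lambda>y. of_real (bump_source k c r y))"
  unfolding first_kind_solution_def
proof
  fix x assume "x \<in> D"
  hence x: "x \<notin> cball c r"
    using P D by auto
  let ?g = "\<lambda>y. helmholtz_green k x y * of_real (bump_source k c r y)"
  \<comment> \<open>The source vanishes off the ball, which lies in \<open>P\<close>, so integrating
    over \<open>P\<close> is integrating over the whole space.\<close>
  have g: "(\<lambda>y. indicat_real P y *\<^sub>R ?g y) = ?g"
    using bump_source_eq_0[OF r] P by (force simp: indicator_def)
  note int = integral_green_bump_source[OF r x, of k]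
  \<comment> \<open>Integrability and value pass from Borel measure to its completion because the
    integrand is Borel measurable.\<close>
  hence "integrable lebesgue ?g \<and> integral\<^sup>L lebesgue ?g = 0"
    by (simp add: integrable_completion integral_completion borel_measurable_integrable)
  thus "set_integrable lebesgue P ?g \<and> (LINT y:P|lebesgue. ?g y) = 0"
    by (simp add: set_integrable_def set_lebesgue_integral_def g)
qed

text \<open>By linearity, adding a non-trivial homogeneous solution keeps the right-hand side and
  alters \<open>J\<close> on a non-null part of \<open>P\<close>.\<close>

lemma solutions_never_unique_if_nontrivial_homogeneous:
  assumes "has_nontrivial_homogeneous_solution k P D"
  shows "solutions_never_unique k P D"
  unfolding solutions_never_unique_def
proof (intro allI impI)
  fix u J
  assume J: "first_kind_solution k P D u J"
  obtain J\<^sub>0 where J\<^sub>0: "first_kind_solution k P D (\<lambda>x. 0) J\<^sub>0" "\<not> eq_ae_on P J\<^sub>0 (\<lambda>y. 0)"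
    using assms by (auto simp: has_nontrivial_homogeneous_solution_def)
  have "first_kind_solution k P D u (\<lambda>y. J y + J\<^sub>0 y)"
    using J J\<^sub>0(1) by (auto simp: first_kind_solution_def distrib_left)
  moreover have "\<not> eq_ae_on P J (\<lambda>y. J y + J\<^sub>0 y)"
    using J\<^sub>0(2) by (simp add: eq_ae_on_def)
  ultimately show "\<exists>J'. first_kind_solution k P D u J' \<and> \<not> eq_ae_on P J J'"
    by blast
qed

text \<open>Any closed ball inside \<open>P\<close> carries a suitable source, so one argument
  serves both parallelepipeds and domains of arbitrary shape.\<close>

lemma has_nontrivial_homogeneous_solution_open:
  assumes "open P" "P \<noteq> {}" "D \<inter> P = {}"
  shows "has_nontrivial_homogeneous_solution k P D"
proof -
  obtain c r where cr: "r > 0" "cball c r \<subseteq> P"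
    using assms open_contains_cball by blast
  hence "ball c r \<subseteq> P"
    using ball_subset_cball by blast
  thus ?thesis
    unfolding has_nontrivial_homogeneous_solution_def
    using first_kind_solution_bump_source[OF cr assms(3)] not_eq_ae_on_bump_source[OF cr(1)] by blast
qed

theorem mainTheorem6:
  fixes D :: "(real^3) set"
  assumes "domain D" and "bounded D"
  shows "(\<forall>a b :: real^3. (\<forall>j. a $ j < b $ j) \<and> closure D \<inter> closure (box a b) = {} \<longrightarrow>
           (\<forall>k>0. has_nontrivial_homogeneous_solution k (box a b) D \<and>
                  solutions_never_unique k (box a b) D)) \<and>
         (\<forall>P :: (real^3) set. domain P \<and> bounded P \<and> closure D \<inter> closure P = {} \<longrightarrow>
           (\<forall>k>0. has_nontrivial_homogeneous_solution k P D \<and>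
                  solutions_never_unique k P D))"
proof -
  have main: "has_nontrivial_homogeneous_solution k P D \<and> solutions_never_unique k P D"
    if "open P" "P \<noteq> {}" "closure D \<inter> closure P = {}" for k P
  proof -
    have "D \<inter> P = {}"
      using that(3) closure_subset by blast
    thus ?thesis
      using has_nontrivial_homogeneous_solution_open that(1,2)
        solutions_never_unique_if_nontrivial_homogeneous by blast
  qed
  have "box a b \<noteq> {}" if "\<forall>j. a $ j < b $ j" for a b :: "real^3"
    using that by (auto simp: box_ne_empty cart_eq_inner_axis Basis_vec_def)
  hence "\<forall>a b :: real^3. (\<forall>j. a $ j < b $ j) \<and> closure D \<inter> closure (box a b) = {} \<longrightarrow>
      (\<forall>k>0. has_nontrivial_homogeneous_solution k (box a b) D \<and>
             solutions_never_unique k (box a b) D)"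
    using main[OF open_box] by blast
  thus ?thesis
    using main unfolding domain_def by blast
qed

end
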